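(* Let $F$ be a finite field, let $i<j$ be positive integers, and let $n=i+j$. Then there exists a bijective nesting map of sets $f\colon \operatorname{Gr}(i,F^n)\to \operatorname{Gr}(j,F^n)$, i.e. a bijection $f$ such that $l\subset f(l)$ for every $l\in \operatorname{Gr}(i,F^n)$.
   Context: For a field $F$, $\operatorname{Gr}(i,F^n)$ denotes the set of $i$-dimensional linear subspaces of $F^n$. A map $f\colon \operatorname{Gr}(i,F^n)\to\operatorname{Gr}(j,F^n)$ is called nesting if $l\subset f(l)$ for every $l\in\operatorname{Gr}(i,F^n)$. *)

theory Defs
  imports "HOL-Analysis.Cartesian_Space"
begin

text \<open>The set of \<open>i\<close>-dimensional linear subspaces of \<open>F\<^sup>n\<close>, where the dimension
  \<open>n\<close> is the cardinality of the index type \<open>'n\<close>. The prefix \<open>vec\<close> refers to the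
  vector space over an arbitrary field given by componentwise scaling (not the real
  vector space structure).\<close>

definition Gr :: "nat \<Rightarrow> (('a::field) ^ 'n::finite) set set" where
  "Gr i = {l. vec.subspace l \<and> vec.dim l = i}"

definition nesting ::
  "nat \<Rightarrow> nat \<Rightarrow> ((('a::field) ^ 'n::finite) set \<Rightarrow> ('a ^ 'n) set) \<Rightarrow> bool" where
  "nesting i j f \<longleftrightarrow> f \<in> Gr i \<rightarrow> Gr j \<and> (\<forall>l \<in> Gr i. l \<subseteq> f l)"

end

theory Submission
  imports Defs
begin

text \<open>The containment relation between \<open>Gr i\<close> and \<open>Gr j\<close> is a bipartite graph on which
  \<open>GL n\<close> acts transitively on each side, so all vertices of one side have the same degree.
  The two sides are equinumerous, since taking orthogonal complements for the standard bilinear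
  form exchanges dimension \<open>i\<close> with dimension \<open>n - i = j\<close>; hence the two degrees
  agree, and a regular bipartite graph has a perfect matching by Hall's theorem.\<close>

section \<open>Matchings in bipartite graphs\<close>

text \<open>Strong induction on the index set. If some nonempty proper subfamily is tight, it is
  matched first and the rest is matched outside its union; if none is tight, one arbitrary choice
  can be fixed and the rest still satisfies Hall's condition.\<close>

theorem Hall_marriage:
  fixes A :: "'i \<Rightarrow> 'x set"
  assumes "finite I" and "\<And>i. i \<in> I \<Longrightarrow> finite (A i)"
    and "\<And>J. J \<subseteq> I \<Longrightarrow> card J \<le> card (\<Union>(A ` J))"
  shows "\<exists>f. inj_on f I \<and> (\<forall>i\<in>I. f i \<in> A i)"
  using assms
proof (induction I arbitrary: A rule: finite_psubset_induct)
  case (psubset I)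
  note fin = psubset.prems(1) and hall = psubset.prems(2)
  have finU: "finite (\<Union>(A ` J))" if "J \<subseteq> I" for J
    using that fin finite_subset[OF that psubset.hyps] by auto
  show ?case
  proof (cases "\<exists>J. J \<noteq> {} \<and> J \<subset> I \<and> card (\<Union>(A ` J)) \<le> card J")
    case True
    then obtain J where J: "J \<noteq> {}" "J \<subset> I" and tight: "card (\<Union>(A ` J)) \<le> card J"
      by blast
    define U where "U = \<Union>(A ` J)"
    have "finite J" using J psubset.hyps finite_subset by blast
    have "finite U" unfolding U_def using J by (intro finU) auto
    have "\<exists>f. inj_on f J \<and> (\<forall>i\<in>J. f i \<in> A i)"
      using J fin hall by (intro psubset.IH) auto
    then obtain f where f: "inj_on f J" "\<And>i. i \<in> J \<Longrightarrow> f i \<in> A i" by blast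
    have "\<exists>g. inj_on g (I - J) \<and> (\<forall>i\<in>I - J. g i \<in> A i - U)"
    proof (rule psubset.IH)
      show "I - J \<subset> I" using J by auto
      show "finite (A i - U)" if "i \<in> I - J" for i using that fin by auto
      fix L assume L: "L \<subseteq> I - J"
      \<comment> \<open>Hall's condition for \<open>L \<union> J\<close>, less the tight part:
        \<open>U\<close> accounts for at most \<open>card J\<close> elements of the union.\<close>
      have "card J + card L = card (L \<union> J)"
        using L \<open>finite J\<close> finite_subset[OF L] psubset.hyps
        by (subst card_Un_disjoint) auto
      also have "\<dots> \<le> card (\<Union>(A ` (L \<union> J)))" using L J by (intro hall) auto
      also have "\<Union>(A ` (L \<union> J)) = (\<Union>i\<in>L. A i - U) \<union> U" by (auto simp: U_def)
      also have "card \<dots> \<le> card (\<Union>i\<in>L. A i - U) + card U" by (rule card_Un_le)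
      finally show "card L \<le> card (\<Union>i\<in>L. A i - U)" using tight by (simp add: U_def)
    qed
    then obtain g where g: "inj_on g (I - J)" "\<And>i. i \<in> I - J \<Longrightarrow> g i \<in> A i - U" by blast
    \<comment> \<open>Values of \<open>f\<close> lie in \<open>U\<close> and those of
      \<open>g\<close> outside it, so gluing them cannot create a collision.\<close>
    have fU: "f i \<in> U" if "i \<in> J" for i using f(2)[OF that] that by (auto simp: U_def)
    let ?h = "\<lambda>i. if i \<in> J then f i else g i"
    have "inj_on ?h I"
    proof (rule inj_onI)
      fix x y assume "x \<in> I" "y \<in> I" "?h x = ?h y"
      then show "x = y"
        using g(2)[of x] g(2)[of y] fU[of x] fU[of y] inj_onD[OF f(1), of x y]
          inj_onD[OF g(1), of x y] by (auto split: if_splits)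
    qed
    moreover have "\<forall>i\<in>I. ?h i \<in> A i" using f(2) g(2) by auto
    ultimately show ?thesis by blast
  next
    case strict: False
    show ?thesis
    proof (cases "I = {}")
      case False
      then obtain a where a: "a \<in> I" by blast
      have "card {a} \<le> card (\<Union>(A ` {a}))" using a by (intro hall) auto
      then have "A a \<noteq> {}" by auto
      then obtain x where x: "x \<in> A a" by blast
      have "\<exists>g. inj_on g (I - {a}) \<and> (\<forall>i\<in>I - {a}. g i \<in> A i - {x})"
      proof (rule psubset.IH)
        show "I - {a} \<subset> I" using a by auto
        show "finite (A i - {x})" if "i \<in> I - {a}" for i using that fin by auto
        fix L assume L: "L \<subseteq> I - {a}"
        have eq: "(\<Union>i\<in>L. A i - {x}) = \<Union>(A ` L) - {x}" by auto
        show "card L \<le> card (\<Union>i\<in>L. A i - {x})"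
        proof (cases "L = {}")
          case False
          moreover have "L \<subset> I" using L a by auto
          \<comment> \<open>Without tight subfamilies the inequality is strict, and the spare
            element pays for the removal of \<open>x\<close>.\<close>
          ultimately have "card L < card (\<Union>(A ` L))" using strict not_le by blast
          then show ?thesis unfolding eq
            using diff_card_le_card_Diff[of "{x}" "\<Union>(A ` L)"] by simp
        qed auto
      qed
      then obtain g where g: "inj_on g (I - {a})" "\<And>i. i \<in> I - {a} \<Longrightarrow> g i \<in> A i - {x}"
        by blast
      have "inj_on (g(a := x)) I"
      proof (rule inj_onI)
        fix y z assume "y \<in> I" "z \<in> I" "(g(a := x)) y = (g(a := x)) z"
        then show "y = z"
          using g(2)[of y] g(2)[of z] inj_onD[OF g(1), of y z] by (auto split: if_splits)
      qed
      moreover have "\<forall>i\<in>I. (g(a := x)) i \<in> A i" using g(2) x by auto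
      ultimately show ?thesis by blast
    qed auto
  qed
qed

text \<open>Counting the edges that leave \<open>S\<close> gives
  \<open>d * card S \<le> d * card ?N\<close>, which is Hall's condition. Counting all edges gives
  \<open>card X = card Y\<close>, so the injective matching is onto.\<close>

corollary regular_bipartite_perfect_matching:
  assumes finX: "finite X" and finY: "finite Y" and "0 < d"
    and degX: "\<And>x. x \<in> X \<Longrightarrow> card {y \<in> Y. R x y} = d"
    and degY: "\<And>y. y \<in> Y \<Longrightarrow> card {x \<in> X. R x y} = d"
  shows "\<exists>f. bij_betw f X Y \<and> (\<forall>x\<in>X. R x (f x))"
proof -
  have "\<exists>f. inj_on f X \<and> (\<forall>x\<in>X. f x \<in> {y \<in> Y. R x y})"
  proof (rule Hall_marriage)
    fix S assume S: "S \<subseteq> X"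
    have finS: "finite S" using S finX finite_subset by blast
    let ?N = "\<Union>x\<in>S. {y \<in> Y. R x y}"
    have N: "finite ?N" "?N \<subseteq> Y" using finY by (auto intro: finite_subset[of _ Y])
    have "d * card S = (\<Sum>x\<in>S. card {y \<in> ?N. R x y})"
    proof -
      have "card {y \<in> ?N. R x y} = d" if "x \<in> S" for x
      proof -
        have "{y \<in> ?N. R x y} = {y \<in> Y. R x y}" using that by auto
        then show ?thesis using degX that S by auto
      qed
      then show ?thesis by simp
    qed
    also have "\<dots> = (\<Sum>y\<in>?N. card {x \<in> S. R x y})"
      by (rule sum_multicount_gen) (use finS N in auto)
    also have "\<dots> \<le> (\<Sum>y\<in>?N. d)"
    proof (rule sum_mono)
      fix y assume "y \<in> ?N"
      then have "card {x \<in> X. R x y} = d" using degY by auto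
      moreover have "card {x \<in> S. R x y} \<le> card {x \<in> X. R x y}"
        using S finX by (intro card_mono) auto
      ultimately show "card {x \<in> S. R x y} \<le> d" by simp
    qed
    finally show "card S \<le> card ?N" using \<open>0 < d\<close> by (simp add: mult.commute)
  qed (use finX finY in auto)
  then obtain f where f: "inj_on f X" "\<And>x. x \<in> X \<Longrightarrow> f x \<in> Y \<and> R x (f x)" by blast
  have "d * card X = d * card Y"
    using sum_multicount[OF finX finY, of R d] degX degY by auto
  then have "card (f ` X) = card Y" using \<open>0 < d\<close> card_image[OF f(1)] by simp
  moreover have "f ` X \<subseteq> Y" using f(2) by auto
  ultimately have "f ` X = Y" using finY card_subset_eq by blast
  then show ?thesis using f by (auto simp: bij_betw_def)
qed

section \<open>Linear automorphisms acting on subspaces\<close>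

text \<open>A bijection between bases of \<open>l\<close> and \<open>m\<close> extends to an
  injective linear map of the whole space, which is onto by finite dimension.\<close>

lemma Gr_transitive:
  fixes l m :: "('a::field ^ 'n::finite) set"
  assumes "l \<in> Gr i" and "m \<in> Gr i"
  obtains g where "Vector_Spaces.linear (*s) (*s) g" and "bij g" and "g ` l = m"
proof -
  obtain B where B: "finite B" "vec.independent B" "vec.span B = l" "card B = i"
    using assms(1) vec.basis_subspace_exists[of l] unfolding Gr_def by blast
  obtain C where C: "finite C" "vec.independent C" "vec.span C = m" "card C = i"
    using assms(2) vec.basis_subspace_exists[of m] unfolding Gr_def by blast
  obtain h where h: "bij_betw h B C"
    using finite_same_card_bij[OF B(1) C(1)] B(4) C(4) by auto
  obtain g where g: "Vector_Spaces.linear (*s) (*s) g" "inj g" "\<forall>x\<in>B. g x = h x"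
    using vec.linear_independent_extend_inj[of B h] B C h
    by (auto simp: bij_betw_def)
  have "surj g" using vec.linear_injective_imp_surjective[OF g(1,2)] by simp
  have "g ` l = vec.span (g ` B)"
    using vec.linear_span_image[OF g(1), of B] B(3) by simp
  also have "g ` B = C" using g(3) h by (auto simp: bij_betw_def)
  finally have "g ` l = m" using C(3) by simp
  with g \<open>surj g\<close> show ?thesis by (intro that[of g]) (auto simp: bij_def)
qed

lemma Gr_image:
  fixes g :: "'a::field ^ 'n::finite \<Rightarrow> 'a ^ 'n"
  assumes "Vector_Spaces.linear (*s) (*s) g" and "inj g" and "l \<in> Gr i"
  shows "g ` l \<in> Gr i"
  using assms vec.linear_subspace_image[OF assms(1), of l]
    vec.dim_image_eq[OF assms(1), of l]
  by (auto simp: Gr_def intro: inj_on_subset)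

lemma bij_betw_image_Gr:
  fixes g :: "'a::field ^ 'n::finite \<Rightarrow> 'a ^ 'n"
  assumes g: "Vector_Spaces.linear (*s) (*s) g" and "bij g"
  shows "bij_betw ((`) g) (Gr i) (Gr i)"
proof -
  obtain h where h: "Vector_Spaces.linear (*s) (*s) h" "\<And>x. h (g x) = x" "\<And>x. g (h x) = x"
    using vec.linear_surjective_isomorphism[OF g] \<open>bij g\<close> by (auto simp: bij_def)
  have inj: "inj g" "inj h" using h(2,3) by (metis injI)+
  show ?thesis
    by (rule bij_betwI[where g = "(`) h"])
      (auto simp: image_image h(2,3) intro!: Gr_image g h(1) inj)
qed

text \<open>An automorphism taking \<open>l\<close> to \<open>m\<close> permutes \<open>Gr j\<close>
  and carries the neighbours of \<open>l\<close> to those of \<open>m\<close>. Keeping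
  \<open>R\<close> abstract covers containment in both directions.\<close>

lemma card_Gr_related_eq:
  fixes l m :: "('a::field ^ 'n::finite) set"
  assumes "l \<in> Gr i" and "m \<in> Gr i"
    and inv: "\<And>g k. bij g \<Longrightarrow> R (g ` l) (g ` k) \<longleftrightarrow> R l k"
  shows "card {k \<in> Gr j. R l k} = card {k \<in> Gr j. R m k}"
proof -
  obtain g where g: "Vector_Spaces.linear (*s) (*s) g" "bij g" "g ` l = m"
    using Gr_transitive[OF assms(1,2)] by blast
  have bij: "bij_betw ((`) g) (Gr j) (Gr j)" by (rule bij_betw_image_Gr[OF g(1,2)])
  have R: "R m (g ` k) \<longleftrightarrow> R l k" for k using inv[OF g(2), of k] unfolding g(3) .
  have "(`) g ` {k \<in> Gr j. R l k} = {k \<in> (`) g ` Gr j. R m k}"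
    using R by blast
  then have "(`) g ` {k \<in> Gr j. R l k} = {k \<in> Gr j. R m k}"
    unfolding bij_betw_imp_surj_on[OF bij] .
  then have "bij_betw ((`) g) {k \<in> Gr j. R l k} {k \<in> Gr j. R m k}"
    by (intro bij_betw_subset[OF bij]) auto
  then show ?thesis by (rule bij_betw_same_card)
qed

section \<open>Duality\<close>

definition annihilator :: "('a::field ^ 'n::finite) set \<Rightarrow> ('a ^ 'n) set" where
  "annihilator S = {x. \<forall>y\<in>S. (\<Sum>k\<in>UNIV. x $ k * y $ k) = 0}"

lemma dot_matrix_vector_transpose:
  fixes A :: "'a::field ^ 'n::finite ^ 'n"
  shows "(\<Sum>k\<in>UNIV. x $ k * (A *v y) $ k) = (\<Sum>k\<in>UNIV. (transpose A *v x) $ k * y $ k)"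
proof -
  have "(\<Sum>k\<in>UNIV. x $ k * (A *v y) $ k) = (\<Sum>k\<in>UNIV. \<Sum>j\<in>UNIV. x $ k * (A $ k $ j * y $ j))"
    by (simp add: matrix_vector_mult_def sum_distrib_left)
  also have "\<dots> = (\<Sum>j\<in>UNIV. \<Sum>k\<in>UNIV. x $ k * (A $ k $ j * y $ j))" by (rule sum.swap)
  also have "\<dots> = (\<Sum>k\<in>UNIV. (transpose A *v x) $ k * y $ k)"
    by (simp add: matrix_vector_mult_def transpose_def sum_distrib_left mult_ac)
  finally show ?thesis .
qed

text \<open>The transpose is the adjoint for the form, so the left side is the preimage of
  \<open>annihilator S\<close> under \<open>transpose A\<close>, whose inverse is
  \<open>transpose B\<close>.\<close>

lemma annihilator_image:
  fixes A B :: "'a::field ^ 'n::finite ^ 'n"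
  assumes "A ** B = mat 1" and "B ** A = mat 1"
  shows "annihilator ((*v) A ` S) = (*v) (transpose B) ` annihilator S"
proof -
  have "transpose A *v (transpose B *v x) = x" "transpose B *v (transpose A *v x) = x" for x
    using assms by (simp_all add: matrix_vector_mul_assoc matrix_transpose_mul[symmetric]
        del: transpose_matrix_vector)
  then have "(*v) (transpose B) ` T = {x. transpose A *v x \<in> T}" for T
    by (auto simp: image_iff) metis
  then show ?thesis by (simp add: annihilator_def dot_matrix_vector_transpose)
qed

text \<open>These serve as representatives of the \<open>GL n\<close>-orbits of subspaces, on which
  the annihilator can be computed by hand.\<close>

definition coordinate_subspace :: "'n set \<Rightarrow> ('a::field ^ 'n::finite) set" where
  "coordinate_subspace K = {x. \<forall>k. k \<notin> K \<longrightarrow> x $ k = 0}"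

lemma coordinate_subspace_in_Gr: "coordinate_subspace K \<in> Gr (card K)"
  unfolding Gr_def coordinate_subspace_def
  by (auto simp: dim_substandard_cart vec.subspace_def)

lemma annihilator_coordinate_subspace:
  "annihilator (coordinate_subspace K) = coordinate_subspace (- K)"
proof (intro equalityI subsetI)
  fix x :: "'a ^ 'b" assume x: "x \<in> annihilator (coordinate_subspace K)"
  have "x $ k = 0" if "k \<in> K" for k
  proof -
    \<comment> \<open>Pairing with this unit vector isolates the coordinate
      \<open>x $ k\<close>.\<close>
    have "axis k 1 \<in> (coordinate_subspace K :: ('a ^ 'b) set)"
      using that by (auto simp: coordinate_subspace_def axis_def)
    then have "(\<Sum>m\<in>UNIV. x $ m * axis k 1 $ m) = 0" using x by (simp add: annihilator_def)
    then show ?thesis by (simp add: axis_def if_distrib cong: if_cong)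
  qed
  then show "x \<in> coordinate_subspace (- K)" by (simp add: coordinate_subspace_def)
next
  fix x :: "'a ^ 'b" assume x: "x \<in> coordinate_subspace (- K)"
  have "x $ k * y $ k = 0" if "y \<in> coordinate_subspace K" for y k
    using x that by (cases "k \<in> K") (auto simp: coordinate_subspace_def)
  then show "x \<in> annihilator (coordinate_subspace K)"
    by (auto simp: annihilator_def intro!: sum.neutral)
qed

text \<open>Over a general field \<open>l\<close> may meet its annihilator nontrivially, so no
  orthogonal decomposition is available. Instead an invertible matrix reduces \<open>l\<close> to a
  coordinate subspace.\<close>

lemma annihilator_Gr:
  fixes l :: "('a::field ^ 'n::finite) set"
  assumes "l \<in> Gr i" and n: "CARD('n) = i + j"
  shows "annihilator l \<in> Gr j" and "annihilator (annihilator l) = l"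
proof -
  obtain K :: "'n set" where K: "card K = i"
    using obtain_subset_with_card_n[of i "UNIV :: 'n set"] n by auto
  then have K': "card (- K) = j" using n by (simp add: Compl_eq_Diff_UNIV card_Diff_subset)
  obtain g where g: "Vector_Spaces.linear (*s) (*s) g" "bij g" "g ` coordinate_subspace K = l"
    using Gr_transitive coordinate_subspace_in_Gr[of K] assms(1) unfolding K by blast
  define A where "A = matrix g"
  have gA: "g = (*v) A" using matrix_works[OF g(1)] by (simp add: A_def fun_eq_iff)
  have "inj ((*v) A)" using g(2) gA by (simp add: bij_def)
  then obtain B where B: "B ** A = mat 1" using matrix_left_invertible_injective[of A] by blast
  then have B': "A ** B = mat 1" using matrix_left_right_inverse by blast
  have l: "l = (*v) A ` coordinate_subspace K" using g(3) gA by simp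
  have ann: "annihilator l = (*v) (transpose B) ` coordinate_subspace (- K)"
    unfolding l annihilator_image[OF B' B] annihilator_coordinate_subspace ..
  have T: "transpose B ** transpose A = mat 1" "transpose A ** transpose B = mat 1"
    using B B' by (simp_all add: matrix_transpose_mul[symmetric])
  then have "inj ((*v) (transpose B))" using matrix_left_invertible_injective by blast
  then show "annihilator l \<in> Gr j"
    unfolding ann using coordinate_subspace_in_Gr[of "- K"] K'
    by (intro Gr_image) auto
  \<comment> \<open>The second annihilator transposes and complements once more, which restores both
    \<open>A\<close> and \<open>K\<close>.\<close>
  show "annihilator (annihilator l) = l"
    unfolding ann annihilator_image[OF T] annihilator_coordinate_subspace
    by (simp add: l)
qed

lemma card_Gr_dual:
  assumes "CARD('n::finite) = i + j"
  shows "card (Gr i :: ('a::field ^ 'n) set set) = card (Gr j :: ('a ^ 'n) set set)"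
proof -
  have "bij_betw annihilator (Gr i :: ('a ^ 'n) set set) (Gr j)"
    using assms annihilator_Gr[where ?'n = 'n, of _ i j] annihilator_Gr[where ?'n = 'n, of _ j i]
    by (intro bij_betwI[where g = annihilator] funcsetI) (simp_all add: add.commute)
  then show ?thesis by (rule bij_betw_same_card)
qed

theorem theorem1p1:
  fixes i j :: nat
  assumes "0 < i" and "i < j" and "CARD('n::finite) = i + j"
  shows "\<exists>f :: (('a::{field,finite}) ^ 'n) set \<Rightarrow> ('a ^ 'n) set.
           nesting i j f \<and> bij_betw f (Gr i) (Gr j)"
proof -
  let ?X = "Gr i :: ('a ^ 'n) set set" and ?Y = "Gr j :: ('a ^ 'n) set set"
  \<comment> \<open>A pair \<open>l \<subseteq> m\<close> is built to witness that the common degree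
    \<open>d\<close> is positive; this is where \<open>i < j\<close> enters.\<close>
  have "j \<le> vec.dim (UNIV :: ('a ^ 'n) set)" unfolding vec_dim_card using assms(3) by simp
  then obtain m where m: "m \<in> ?Y"
    using vec.choose_subspace_of_subspace unfolding Gr_def by blast
  then have "i \<le> vec.dim m" and span: "vec.span m = m"
    using assms(2) by (simp_all add: Gr_def)
  then obtain l where "vec.subspace l" "l \<subseteq> vec.span m" "vec.dim l = i"
    using vec.choose_subspace_of_subspace[of i m] by blast
  then have l: "l \<in> ?X" "l \<subseteq> m" unfolding span by (simp_all add: Gr_def)
  define d where "d = card {k \<in> ?X. k \<subseteq> m}"
  have "0 < d" unfolding d_def using l by (auto simp: card_gt_0_iff)
  have degY: "card {k \<in> ?X. k \<subseteq> y} = d" if "y \<in> ?Y" for y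
    unfolding d_def using that m
    by (intro card_Gr_related_eq[where R = "\<lambda>a b. b \<subseteq> a"]) (auto simp: bij_def inj_image_subset_iff)
  define e where "e = card {k \<in> ?Y. l \<subseteq> k}"
  have degX: "card {k \<in> ?Y. x \<subseteq> k} = e" if "x \<in> ?X" for x
    unfolding e_def using that l(1)
    by (intro card_Gr_related_eq[where R = "(\<subseteq>)"]) (auto simp: bij_def inj_image_subset_iff)
  \<comment> \<open>The incidences are counted from both sides; since the sides have equal nonzero
    size, the two degrees agree.\<close>
  have "card ?X * e = d * card ?Y"
    using sum_multicount[of ?X ?Y "(\<subseteq>)" d] degX degY by simp
  moreover have "card ?X = card ?Y" by (rule card_Gr_dual[OF assms(3)])
  moreover have "0 < card ?X" using l by (auto simp: card_gt_0_iff)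
  ultimately have "e = d" by auto
  then obtain f where "bij_betw f ?X ?Y" "\<forall>x\<in>?X. x \<subseteq> f x"
    using regular_bipartite_perfect_matching[of ?X ?Y d "(\<subseteq>)"] degX degY \<open>0 < d\<close> by auto
  then show ?thesis unfolding nesting_def using bij_betw_imp_funcset by blast
qed

end
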